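(* Let $T$ be an arbitrary theory (set of formulas of $\mathsf{SE}$) and $F$ a formula. If $T \Vdash F$, then $T \vdash_{\mathsf{SE}} F$.
   Context: Syntax of $\mathsf{SE}$. There are countably infinite sets of justification constants $\mathsf{JConst}=\{0,1,c_1,c_2,\dots\}$ (with two distinguished constants $0,1$) and justification variables $\mathsf{JVar}=\{x_1,x_2,\dots\}$. Terms: every constant and every variable is a term; if $s,t$ are terms then so are $s\cdot t$ and $s+t$. Formulas are built from $\bot$, atomic propositions $P$ from a countable set $\mathsf{Prop}$, implication $A\to B$, and $t:A$ for a term $t$ and formula $A$; $\neg,\wedge,\vee,\leftrightarrow$ are the usual abbreviations. $A[w/t]$ denotes the result of simultaneously replacing all occurrences of the variable $w$ in $A$ by the term $t$. Axioms of $\mathsf{SE}$ (for arbitrary formulas $A,B$ and variables $w,x,y,z$): (CL) all instances of propositional tautologies; (j) $x:(A\to B)\to(y:A\to x\cdot y:B)$; (j+) $x:A\wedge y:A\to(x+y):A$; (a+) $A[w/(x+y)+z]\to A[w/x+(y+z)]$; (c+) $A[w/x+y]\to A[w/y+x]$; (0+) $A[w/x+0]\leftrightarrow A[w/x]$; (am) $A[w/(x\cdot y)\cdot z]\leftrightarrow A[w/x\cdot(y\cdot z)]$; (a0) $A[w/x\cdot 0]\leftrightarrow A[w/0]$ and $A[w/0\cdot x]\leftrightarrow A[w/0]$; (a1) $A[w/x\cdot 1]\leftrightarrow A[w/x]$ and $A[w/1\cdot x]\leftrightarrow A[w/x]$; (dl) $A[w/x\cdot(y+z)]\leftrightarrow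 A[w/x\cdot y+x\cdot z]$; (dr) $A[w/(y+z)\cdot x]\leftrightarrow A[w/y\cdot x+z\cdot x]$. Rules: modus ponens and (jv): from $A$ infer $A[x/t]$ for any variable $x$ and term $t$. A theory is a set $T$ of formulas; $T\vdash_{\mathsf{SE}}F$ means $F$ has a derivation using axioms, members of $T$, and the two rules. Semantics. A semiring $K=(S,+,\cdot,0,1)$ satisfies: $+$ associative and commutative with neutral $0$; $\cdot$ associative with neutral $1$ (not necessarily commutative); both distributive laws; $a\cdot 0=0\cdot a=0$. An interpretation is a map $I:\mathsf{JConst}\to S$ with $I(0)=0$, $I(1)=1$; a valuation is a map $v:\mathsf{JVar}\to S$. For a term $t$, $t_I^v\in S$ is defined by $c_I^v=I(c)$, $x_I^v=v(x)$, $(s+t)_I^v=s_I^v+t_I^v$, $(s\cdot t)_I^v=s_I^v\cdot t_I^v$. $\mathsf{Fml}_S$ is the set of formulas built like ordinary formulas but with elements of $S$ in place of terms; $A_I^v\in\mathsf{Fml}_S$ replaces each term $t$ in $A$ by $t_I^v$. An evidence relation is $J\subseteq S\times \mathsf{Fml}_S$ such that $J(s,A\to B)$ and $J(t,A)$ imply $J(s\cdot t,B)$, and $J(s,A)$ and $J(t,A)$ imply $J(s+t,A)$. A semiring model is $M=(K,*,I,J)$ with $K$ a semiring, $*:\mathsf{Prop}\to\{\mathbb F,\mathbb T\}$, $I$ an interpretation, $J$ an evidence relation. Truth: $M,v\not\Vdash\bot$; $M,v\Vdash P$ iff $P^*=\mathbb T$; $M,v\Vdash A\to B$ iff $M,v\not\Vdash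 A$ or $M,v\Vdash B$; $M,v\Vdash s:A$ iff $J(s_I^v,A_I^v)$. $M\Vdash A$ iff $M,v\Vdash A$ for all valuations $v$; $M\Vdash T$ iff $M\Vdash A$ for all $A\in T$. $T\Vdash F$ iff every semiring model $M$ with $M\Vdash T$ satisfies $M\Vdash F$. *)

theory Defs
  imports "HOL-Algebra.Ring" "HOL-Library.Countable"
begin

datatype jconst = CZero | COne | C nat

type_synonym jvar = nat

datatype jterm =
    Const jconst
  | Var jvar
  | Times jterm jterm (infixl "\<cdot>\<^sub>j" 75)
  | Plus jterm jterm (infixl "+\<^sub>j" 70)

abbreviation JZero :: jterm ("0\<^sub>j") where "0\<^sub>j \<equiv> Const CZero"
abbreviation JOne :: jterm ("1\<^sub>j") where "1\<^sub>j \<equiv> Const COne"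

text \<open>Formulas are parametrised by the type of their evidence labels \<open>'t\<close>: instantiating it
  with terms gives the formulas of SE, instantiating it with semiring elements gives the
  formulas that occur in evidence relations.\<close>

datatype (evidences: 't, dead 'p) fml =
    Bot ("\<bottom>\<^sub>f")
  | Atom 'p
  | Imp "('t, 'p) fml" "('t, 'p) fml" (infixr "\<rightarrow>\<^sub>f" 55)
  | Just 't "('t, 'p) fml" (infixr "\<Colon>\<^sub>f" 65)
  for map: map_fml

type_synonym 'p formula = "(jterm, 'p) fml"

abbreviation Neg :: "('t, 'p) fml \<Rightarrow> ('t, 'p) fml" ("\<not>\<^sub>f _" [62] 62) where
  "\<not>\<^sub>f A \<equiv> A \<rightarrow>\<^sub>f \<bottom>\<^sub>f"
abbreviation Conj :: "('t, 'p) fml \<Rightarrow> ('t, 'p) fml \<Rightarrow> ('t, 'p) fml" (infixr "\<and>\<^sub>f" 60) where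
  "A \<and>\<^sub>f B \<equiv> \<not>\<^sub>f (A \<rightarrow>\<^sub>f \<not>\<^sub>f B)"
abbreviation Iff :: "('t, 'p) fml \<Rightarrow> ('t, 'p) fml \<Rightarrow> ('t, 'p) fml" (infix "\<leftrightarrow>\<^sub>f" 54) where
  "A \<leftrightarrow>\<^sub>f B \<equiv> (A \<rightarrow>\<^sub>f B) \<and>\<^sub>f (B \<rightarrow>\<^sub>f A)"

primrec subst_term :: "jvar \<Rightarrow> jterm \<Rightarrow> jterm \<Rightarrow> jterm" where
  "subst_term w t (Const c) = Const c"
| "subst_term w t (Var x) = (if x = w then t else Var x)"
| "subst_term w t (r \<cdot>\<^sub>j s) = subst_term w t r \<cdot>\<^sub>j subst_term w t s"
| "subst_term w t (r +\<^sub>j s) = subst_term w t r +\<^sub>j subst_term w t s"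

definition subst :: "'p formula \<Rightarrow> jvar \<Rightarrow> jterm \<Rightarrow> 'p formula" ("_[_'/\<^sub>f _]" [1000, 0, 0] 1000) where
  "A[w/\<^sub>f t] = map_fml (subst_term w t) A"

datatype pform = PBot | PVar nat | PImp pform pform

primrec peval :: "(nat \<Rightarrow> bool) \<Rightarrow> pform \<Rightarrow> bool" where
  "peval h PBot \<longleftrightarrow> False"
| "peval h (PVar n) \<longleftrightarrow> h n"
| "peval h (PImp a b) \<longleftrightarrow> (peval h a \<longrightarrow> peval h b)"

definition tautology :: "pform \<Rightarrow> bool" where
  "tautology a \<longleftrightarrow> (\<forall>h. peval h a)"

primrec pinst :: "(nat \<Rightarrow> 'p formula) \<Rightarrow> pform \<Rightarrow> 'p formula" where
  "pinst \<sigma> PBot = \<bottom>\<^sub>f"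
| "pinst \<sigma> (PVar n) = \<sigma> n"
| "pinst \<sigma> (PImp a b) = pinst \<sigma> a \<rightarrow>\<^sub>f pinst \<sigma> b"

inductive SE_axiom :: "'p formula \<Rightarrow> bool" where
  CL: "tautology a \<Longrightarrow> SE_axiom (pinst \<sigma> a)"
| j: "SE_axiom (Var x \<Colon>\<^sub>f (A \<rightarrow>\<^sub>f B) \<rightarrow>\<^sub>f (Var y \<Colon>\<^sub>f A \<rightarrow>\<^sub>f (Var x \<cdot>\<^sub>j Var y) \<Colon>\<^sub>f B))"
| j_plus: "SE_axiom (Var x \<Colon>\<^sub>f A \<and>\<^sub>f Var y \<Colon>\<^sub>f A \<rightarrow>\<^sub>f (Var x +\<^sub>j Var y) \<Colon>\<^sub>f A)"
| a_plus: "SE_axiom (A[w/\<^sub>f (Var x +\<^sub>j Var y) +\<^sub>j Var z] \<rightarrow>\<^sub>f A[w/\<^sub>f Var x +\<^sub>j (Var y +\<^sub>j Var z)])"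
| c_plus: "SE_axiom (A[w/\<^sub>f Var x +\<^sub>j Var y] \<rightarrow>\<^sub>f A[w/\<^sub>f Var y +\<^sub>j Var x])"
| zero_plus: "SE_axiom (A[w/\<^sub>f Var x +\<^sub>j 0\<^sub>j] \<leftrightarrow>\<^sub>f A[w/\<^sub>f Var x])"
| am: "SE_axiom (A[w/\<^sub>f (Var x \<cdot>\<^sub>j Var y) \<cdot>\<^sub>j Var z] \<leftrightarrow>\<^sub>f A[w/\<^sub>f Var x \<cdot>\<^sub>j (Var y \<cdot>\<^sub>j Var z)])"
| a0_right: "SE_axiom (A[w/\<^sub>f Var x \<cdot>\<^sub>j 0\<^sub>j] \<leftrightarrow>\<^sub>f A[w/\<^sub>f 0\<^sub>j])"
| a0_left: "SE_axiom (A[w/\<^sub>f 0\<^sub>j \<cdot>\<^sub>j Var x] \<leftrightarrow>\<^sub>f A[w/\<^sub>f 0\<^sub>j])"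
| a1_right: "SE_axiom (A[w/\<^sub>f Var x \<cdot>\<^sub>j 1\<^sub>j] \<leftrightarrow>\<^sub>f A[w/\<^sub>f Var x])"
| a1_left: "SE_axiom (A[w/\<^sub>f 1\<^sub>j \<cdot>\<^sub>j Var x] \<leftrightarrow>\<^sub>f A[w/\<^sub>f Var x])"
| dl: "SE_axiom (A[w/\<^sub>f Var x \<cdot>\<^sub>j (Var y +\<^sub>j Var z)]
        \<leftrightarrow>\<^sub>f A[w/\<^sub>f Var x \<cdot>\<^sub>j Var y +\<^sub>j Var x \<cdot>\<^sub>j Var z])"
| dr: "SE_axiom (A[w/\<^sub>f (Var y +\<^sub>j Var z) \<cdot>\<^sub>j Var x]
        \<leftrightarrow>\<^sub>f A[w/\<^sub>f Var y \<cdot>\<^sub>j Var x +\<^sub>j Var z \<cdot>\<^sub>j Var x])"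

inductive SE_derives :: "'p formula set \<Rightarrow> 'p formula \<Rightarrow> bool" (infix "\<turnstile>\<^sub>S\<^sub>E" 50)
  for T :: "'p formula set" where
  ax: "SE_axiom A \<Longrightarrow> T \<turnstile>\<^sub>S\<^sub>E A"
| hyp: "A \<in> T \<Longrightarrow> T \<turnstile>\<^sub>S\<^sub>E A"
| mp: "T \<turnstile>\<^sub>S\<^sub>E A \<rightarrow>\<^sub>f B \<Longrightarrow> T \<turnstile>\<^sub>S\<^sub>E A \<Longrightarrow> T \<turnstile>\<^sub>S\<^sub>E B"
| jv: "T \<turnstile>\<^sub>S\<^sub>E A \<Longrightarrow> T \<turnstile>\<^sub>S\<^sub>E A[x/\<^sub>f t]"

record ('s, 'p) model =
  sring :: "'s ring"
  pval :: "'p \<Rightarrow> bool"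
  interp :: "jconst \<Rightarrow> 's"
  evid :: "('s \<times> ('s, 'p) fml) set"

definition Fml :: "'s set \<Rightarrow> ('s, 'p) fml set" where
  "Fml S = {A. evidences A \<subseteq> S}"

definition interpretation_on :: "'s ring \<Rightarrow> (jconst \<Rightarrow> 's) \<Rightarrow> bool" where
  "interpretation_on K I \<longleftrightarrow>
     (\<forall>c. I c \<in> carrier K) \<and> I CZero = \<zero>\<^bsub>K\<^esub> \<and> I COne = \<one>\<^bsub>K\<^esub>"

definition valuation_on :: "'s ring \<Rightarrow> (jvar \<Rightarrow> 's) \<Rightarrow> bool" where
  "valuation_on K v \<longleftrightarrow> (\<forall>x. v x \<in> carrier K)"

definition evidence_relation :: "'s ring \<Rightarrow> ('s \<times> ('s, 'p) fml) set \<Rightarrow> bool" where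
  "evidence_relation K J \<longleftrightarrow>
     J \<subseteq> carrier K \<times> Fml (carrier K) \<and>
     (\<forall>s t A B. (s, A \<rightarrow>\<^sub>f B) \<in> J \<longrightarrow> (t, A) \<in> J \<longrightarrow> (s \<otimes>\<^bsub>K\<^esub> t, B) \<in> J) \<and>
     (\<forall>s t A. (s, A) \<in> J \<longrightarrow> (t, A) \<in> J \<longrightarrow> (s \<oplus>\<^bsub>K\<^esub> t, A) \<in> J)"

definition semiring_model :: "('s, 'p) model \<Rightarrow> bool" where
  "semiring_model M \<longleftrightarrow>
     semiring (sring M) \<and> interpretation_on (sring M) (interp M) \<and>
     evidence_relation (sring M) (evid M)"

primrec eval_term :: "'s ring \<Rightarrow> (jconst \<Rightarrow> 's) \<Rightarrow> (jvar \<Rightarrow> 's) \<Rightarrow> jterm \<Rightarrow> 's" where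
  "eval_term K I v (Const c) = I c"
| "eval_term K I v (Var x) = v x"
| "eval_term K I v (s \<cdot>\<^sub>j t) = eval_term K I v s \<otimes>\<^bsub>K\<^esub> eval_term K I v t"
| "eval_term K I v (s +\<^sub>j t) = eval_term K I v s \<oplus>\<^bsub>K\<^esub> eval_term K I v t"

definition eval_fml :: "'s ring \<Rightarrow> (jconst \<Rightarrow> 's) \<Rightarrow> (jvar \<Rightarrow> 's) \<Rightarrow> 'p formula \<Rightarrow> ('s, 'p) fml" where
  "eval_fml K I v A = map_fml (eval_term K I v) A"

primrec sat :: "('s, 'p) model \<Rightarrow> (jvar \<Rightarrow> 's) \<Rightarrow> 'p formula \<Rightarrow> bool" where
  "sat M v \<bottom>\<^sub>f \<longleftrightarrow> False"
| "sat M v (Atom P) \<longleftrightarrow> pval M P"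
| "sat M v (A \<rightarrow>\<^sub>f B) \<longleftrightarrow> \<not> sat M v A \<or> sat M v B"
| "sat M v (t \<Colon>\<^sub>f A) \<longleftrightarrow>
     (eval_term (sring M) (interp M) v t, eval_fml (sring M) (interp M) v A) \<in> evid M"

definition valid_in :: "('s, 'p) model \<Rightarrow> 'p formula \<Rightarrow> bool" where
  "valid_in M A \<longleftrightarrow> (\<forall>v. valuation_on (sring M) v \<longrightarrow> sat M v A)"

text \<open>HOL cannot quantify over all types inside a formula, so semantic consequence takes as
  first argument the type \<open>'s\<close> in which the carriers of the semirings live; the carriers
  themselves are arbitrary subsets of that type.\<close>

definition sem_conseq :: "'s itself \<Rightarrow> 'p formula set \<Rightarrow> 'p formula \<Rightarrow> bool" where
  "sem_conseq (_ :: 's itself) T F \<longleftrightarrow>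
     (\<forall>M :: ('s, 'p) model. semiring_model M \<longrightarrow> (\<forall>A\<in>T. valid_in M A) \<longrightarrow> valid_in M F)"

end

theory Submission
  imports Defs
begin

text \<open>
  Canonical model. If \<open>F\<close> is not derivable, Zorn's lemma yields a set \<open>\<Gamma>\<close> of formulas that contains
  all theorems of \<open>T\<close>, omits \<open>F\<close> and behaves like a truth set for implication. Call two terms
  equivalent if they are interchangeable in all members of \<open>\<Gamma>\<close>; the axioms make the quotient a
  semiring, which is countable and hence embeds into every infinite type. Declare \<open>(s, A)\<close> to be
  evidence if \<open>s : A\<close> lies in \<open>\<Gamma>\<close>. A valuation is then a substitution \<open>\<sigma>\<close> up to equivalence,
  and \<open>A\<close> is true under it iff \<open>A\<sigma> \<in> \<Gamma>\<close>. The rule (jv) makes the theorems of \<open>T\<close> closed under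
  substitution, so \<open>T\<close> is valid, while \<open>F\<close> fails under the identity substitution.
\<close>

section \<open>Simultaneous substitution\<close>

primrec tvars :: "jterm \<Rightarrow> jvar set" where
  "tvars (Const c) = {}"
| "tvars (Var x) = {x}"
| "tvars (s \<cdot>\<^sub>j t) = tvars s \<union> tvars t"
| "tvars (s +\<^sub>j t) = tvars s \<union> tvars t"

text \<open>A valuation of the canonical model acts on all variables at once, whereas
  \<open>subst_term\<close> replaces a single one.\<close>

primrec tsub :: "(jvar \<Rightarrow> jterm) \<Rightarrow> jterm \<Rightarrow> jterm" where
  "tsub \<sigma> (Const c) = Const c"
| "tsub \<sigma> (Var x) = \<sigma> x"
| "tsub \<sigma> (s \<cdot>\<^sub>j t) = tsub \<sigma> s \<cdot>\<^sub>j tsub \<sigma> t"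
| "tsub \<sigma> (s +\<^sub>j t) = tsub \<sigma> s +\<^sub>j tsub \<sigma> t"

definition fvars :: "'p formula \<Rightarrow> jvar set" where
  "fvars A = (\<Union>t\<in>evidences A. tvars t)"

definition fsub :: "(jvar \<Rightarrow> jterm) \<Rightarrow> 'p formula \<Rightarrow> 'p formula" where
  "fsub \<sigma> A = map_fml (tsub \<sigma>) A"

lemma fsub_simps [simp]:
  "fsub \<sigma> \<bottom>\<^sub>f = \<bottom>\<^sub>f"
  "fsub \<sigma> (Atom P) = Atom P"
  "fsub \<sigma> (A \<rightarrow>\<^sub>f B) = fsub \<sigma> A \<rightarrow>\<^sub>f fsub \<sigma> B"
  "fsub \<sigma> (t \<Colon>\<^sub>f A) = tsub \<sigma> t \<Colon>\<^sub>f fsub \<sigma> A"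
  by (simp_all add: fsub_def)

lemma finite_tvars: "finite (tvars t)"
  by (induction t) auto

lemma finite_fvars: "finite (fvars A)"
proof -
  have "finite (evidences A)"
    by (induction A) auto
  then show ?thesis
    by (simp add: fvars_def finite_tvars)
qed

lemma tsub_cong: "(\<And>x. x \<in> tvars t \<Longrightarrow> \<sigma> x = \<tau> x) \<Longrightarrow> tsub \<sigma> t = tsub \<tau> t"
  by (induction t) auto

lemma fsub_cong: "(\<And>x. x \<in> fvars A \<Longrightarrow> \<sigma> x = \<tau> x) \<Longrightarrow> fsub \<sigma> A = fsub \<tau> A"
  unfolding fsub_def fvars_def by (intro fml.map_cong0 tsub_cong) auto

lemma tsub_Var [simp]: "tsub Var t = t"
  by (induction t) auto

lemma fsub_Var [simp]: "fsub Var A = A"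
  by (simp add: fsub_def fml.map_ident_strong)

lemma tsub_tsub [simp]: "tsub \<tau> (tsub \<sigma> t) = tsub (\<lambda>x. tsub \<tau> (\<sigma> x)) t"
  by (induction t) auto

lemma fsub_fsub [simp]: "fsub \<tau> (fsub \<sigma> A) = fsub (\<lambda>x. tsub \<tau> (\<sigma> x)) A"
  by (simp add: fsub_def fml.map_comp comp_def)

lemma subst_term_eq_tsub: "subst_term w t s = tsub (Var(w := t)) s"
  by (induction s) auto

lemma subst_eq_fsub: "A[w/\<^sub>f t] = fsub (Var(w := t)) A"
  by (simp add: subst_def fsub_def subst_term_eq_tsub[abs_def])

lemma tsub_upd_fresh: "x \<notin> tvars t \<Longrightarrow> tsub (Var(x := s)) t = t"
  using tsub_cong[of t "Var(x := s)" Var] by fastforce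

text \<open>Rule (jv) replaces one variable at a time, and successive replacements could interfere.
  Renaming the variables of \<open>A\<close> to fresh ones first and then replacing those yields the
  simultaneous substitution.\<close>

lemma jv_fsub:
  assumes "T \<turnstile>\<^sub>S\<^sub>E A"
  shows "T \<turnstile>\<^sub>S\<^sub>E fsub \<sigma> A"
proof -
  obtain N where N: "\<And>x. x \<in> fvars A \<Longrightarrow> x < N"
    using finite_fvars[of A] by (meson finite_nat_set_iff_bounded)
  have "finite ({..<N} \<union> (\<Union>x<N. tvars (\<sigma> x)))"
    by (simp add: finite_tvars)
  \<comment> \<open>\<open>M\<close> exceeds all variables of \<open>A\<close> and of the relevant
    terms \<open>\<sigma> x\<close>, so no shifted variable \<open>y + M\<close> occurs in any of
    them.\<close>
  then obtain M where M: "\<forall>x\<in>{..<N} \<union> (\<Union>x<N. tvars (\<sigma> x)). x < M"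
    by (meson finite_nat_set_iff_bounded)
  have NM: "N \<le> M"
    using M by (metis UnCI lessThan_iff linorder_not_less less_irrefl)
  have fresh: "y + M \<notin> tvars (\<sigma> x)" if "x < N" for x y
    using M that by fastforce
  have rename: "T \<turnstile>\<^sub>S\<^sub>E fsub (\<lambda>x. if x < k then Var (x + M) else Var x) A" if "k \<le> N" for k
    using that
  proof (induction k)
    case 0
    then show ?case using assms by simp
  next
    case (Suc k)
    then have "T \<turnstile>\<^sub>S\<^sub>E fsub (\<lambda>x. if x < k then Var (x + M) else Var x) A"
      by simp
    from SE_derives.jv[OF this, of k "Var (k + M)"] show ?case
      unfolding subst_eq_fsub fsub_fsub
      by (rule back_subst[where P = "SE_derives T"])
        (intro fsub_cong, use Suc.prems NM in auto)
  qed
  have "T \<turnstile>\<^sub>S\<^sub>E fsub (\<lambda>x. if x < k then \<sigma> x else Var (x + M)) A" if "k \<le> N" for k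
    using that
  proof (induction k)
    case 0
    have "fsub (\<lambda>x. if x < N then Var (x + M) else Var x) A = fsub (\<lambda>x. Var (x + M)) A"
      by (intro fsub_cong) (simp add: N)
    then show ?case using rename[of N] by simp
  next
    case (Suc k)
    then have "T \<turnstile>\<^sub>S\<^sub>E fsub (\<lambda>x. if x < k then \<sigma> x else Var (x + M)) A"
      by simp
    from SE_derives.jv[OF this, of "k + M" "\<sigma> k"] show ?case
      unfolding subst_eq_fsub fsub_fsub
      by (rule back_subst[where P = "SE_derives T"])
        (intro fsub_cong, use Suc.prems fresh in \<open>auto simp: tsub_upd_fresh less_Suc_eq\<close>)
  qed
  from this[of N] have "T \<turnstile>\<^sub>S\<^sub>E fsub (\<lambda>x. if x < N then \<sigma> x else Var (x + M)) A"
    by simp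
  moreover have "fsub (\<lambda>x. if x < N then \<sigma> x else Var (x + M)) A = fsub \<sigma> A"
    by (intro fsub_cong) (simp add: N)
  ultimately show ?thesis by simp
qed

section \<open>Truth sets\<close>

lemma SE_taut_K: "T \<turnstile>\<^sub>S\<^sub>E A \<rightarrow>\<^sub>f B \<rightarrow>\<^sub>f A"
  using SE_derives.ax[OF CL[of "PImp (PVar 0) (PImp (PVar 1) (PVar 0))" "\<lambda>n. if n = 0 then A else B"]]
  by (simp add: tautology_def)

lemma SE_taut_S: "T \<turnstile>\<^sub>S\<^sub>E (A \<rightarrow>\<^sub>f B \<rightarrow>\<^sub>f D) \<rightarrow>\<^sub>f (A \<rightarrow>\<^sub>f B) \<rightarrow>\<^sub>f A \<rightarrow>\<^sub>f D"
  using SE_derives.ax[OF CL[of "PImp (PImp (PVar 0) (PImp (PVar 1) (PVar 2)))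
    (PImp (PImp (PVar 0) (PVar 1)) (PImp (PVar 0) (PVar 2)))"
    "\<lambda>n. if n = 0 then A else if n = 1 then B else D"]]
  by (simp add: tautology_def)

lemma SE_taut_refl: "T \<turnstile>\<^sub>S\<^sub>E A \<rightarrow>\<^sub>f A"
  using SE_derives.ax[OF CL[of "PImp (PVar 0) (PVar 0)" "\<lambda>n. A"]]
  by (simp add: tautology_def)

lemma SE_taut_bot: "T \<turnstile>\<^sub>S\<^sub>E \<bottom>\<^sub>f \<rightarrow>\<^sub>f A"
  using SE_derives.ax[OF CL[of "PImp PBot (PVar 0)" "\<lambda>n. A"]]
  by (simp add: tautology_def)

lemma SE_taut_cases: "T \<turnstile>\<^sub>S\<^sub>E (A \<rightarrow>\<^sub>f D) \<rightarrow>\<^sub>f ((A \<rightarrow>\<^sub>f B) \<rightarrow>\<^sub>f D) \<rightarrow>\<^sub>f D"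
  using SE_derives.ax[OF CL[of "PImp (PImp (PVar 0) (PVar 2))
    (PImp (PImp (PImp (PVar 0) (PVar 1)) (PVar 2)) (PVar 2))"
    "\<lambda>n. if n = 0 then A else if n = 1 then B else D"]]
  by (auto simp: tautology_def)

locale truth_set =
  fixes T :: "'p formula set" and \<Gamma> :: "'p formula set"
  assumes derivable_mem: "T \<turnstile>\<^sub>S\<^sub>E A \<Longrightarrow> A \<in> \<Gamma>"
    and Bot_notin: "\<bottom>\<^sub>f \<notin> \<Gamma>"
    and Imp_mem_iff: "A \<rightarrow>\<^sub>f B \<in> \<Gamma> \<longleftrightarrow> (A \<in> \<Gamma> \<longrightarrow> B \<in> \<Gamma>)"

text \<open>Maximality is taken among sets closed under modus ponens only: closure under (jv) would
  destroy the deduction theorem.\<close>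

lemma truth_set_exists:
  fixes T :: "'p formula set"
  assumes "\<not> T \<turnstile>\<^sub>S\<^sub>E F"
  obtains \<Gamma> where "truth_set T \<Gamma>" "F \<notin> \<Gamma>"
proof -
  define \<F> where "\<F> = {\<Gamma>. (\<forall>A. T \<turnstile>\<^sub>S\<^sub>E A \<longrightarrow> A \<in> \<Gamma>) \<and> F \<notin> \<Gamma> \<and>
    (\<forall>A B. A \<rightarrow>\<^sub>f B \<in> \<Gamma> \<longrightarrow> A \<in> \<Gamma> \<longrightarrow> B \<in> \<Gamma>)}"
  have "{A. T \<turnstile>\<^sub>S\<^sub>E A} \<in> \<F>"
    using assms by (auto simp: \<F>_def intro: SE_derives.mp)
  moreover have "\<Union>\<C> \<in> \<F>" if "\<C> \<noteq> {}" and chain: "subset.chain \<F> \<C>" for \<C>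
  proof -
    have mp_closed: "B \<in> \<Union>\<C>" if imp: "A \<rightarrow>\<^sub>f B \<in> \<Union>\<C>" and A: "A \<in> \<Union>\<C>" for A B
    proof -
      obtain X Y where XY: "X \<in> \<C>" "A \<rightarrow>\<^sub>f B \<in> X" "Y \<in> \<C>" "A \<in> Y"
        using imp A by blast
      with chain have "X \<subseteq> Y \<or> Y \<subseteq> X"
        by (auto simp: subset_chain_def)
      then obtain Z where "Z \<in> \<C>" "A \<rightarrow>\<^sub>f B \<in> Z" "A \<in> Z"
        using XY by blast
      moreover have "Z \<in> \<F>"
        using chain \<open>Z \<in> \<C>\<close> by (auto simp: subset_chain_def)
      ultimately show ?thesis
        by (auto simp: \<F>_def)
    qed
    have "\<C> \<subseteq> \<F>"
      using chain by (simp add: subset_chain_def)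
    then have "(\<forall>A. T \<turnstile>\<^sub>S\<^sub>E A \<longrightarrow> A \<in> \<Union>\<C>) \<and> F \<notin> \<Union>\<C>"
      using \<open>\<C> \<noteq> {}\<close> unfolding \<F>_def by blast
    with mp_closed show ?thesis
      unfolding \<F>_def by blast
  qed
  ultimately obtain \<Gamma> where \<Gamma>: "\<Gamma> \<in> \<F>" and max: "\<And>X. X \<in> \<F> \<Longrightarrow> \<Gamma> \<subseteq> X \<Longrightarrow> X = \<Gamma>"
    using subset_Zorn_nonempty[of \<F>] by (metis empty_iff)
  have thms: "A \<in> \<Gamma>" if "T \<turnstile>\<^sub>S\<^sub>E A" for A
    using \<Gamma> that by (auto simp: \<F>_def)
  have mp: "B \<in> \<Gamma>" if "A \<rightarrow>\<^sub>f B \<in> \<Gamma>" "A \<in> \<Gamma>" for A B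
    using \<Gamma> that by (auto simp: \<F>_def)
  have F: "F \<notin> \<Gamma>"
    using \<Gamma> by (simp add: \<F>_def)
  have refutable: "A \<rightarrow>\<^sub>f F \<in> \<Gamma>" if "A \<notin> \<Gamma>" for A
  proof (rule ccontr)
    assume nF: "A \<rightarrow>\<^sub>f F \<notin> \<Gamma>"
    \<comment> \<open>By the deduction theorem, \<open>?X\<close> collects the modus ponens
      consequences of \<open>\<Gamma>\<close> and \<open>A\<close>. Maximality gives
      \<open>?X = \<Gamma>\<close>, contradicting \<open>A \<notin> \<Gamma>\<close>.\<close>
    let ?X = "{B. A \<rightarrow>\<^sub>f B \<in> \<Gamma>}"
    have sub: "\<Gamma> \<subseteq> ?X"
      using mp thms[OF SE_taut_K] by blast
    have "?X \<in> \<F>"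
      unfolding \<F>_def using sub nF thms mp thms[OF SE_taut_S] by blast
    then have "?X = \<Gamma>"
      using max sub by blast
    then show False
      using that thms[OF SE_taut_refl, of A] by blast
  qed
  \<comment> \<open>If \<open>A\<close> and \<open>A \<rightarrow>\<^sub>f B\<close> were both
    absent, each would imply \<open>F\<close> within \<open>\<Gamma>\<close>, and the case
    distinction would put \<open>F\<close> into \<open>\<Gamma>\<close>.\<close>
  have "A \<rightarrow>\<^sub>f B \<in> \<Gamma>" if "A \<notin> \<Gamma>" for A B
    using refutable[OF that] refutable[of "A \<rightarrow>\<^sub>f B"] thms[OF SE_taut_cases] mp F by blast
  moreover have "A \<rightarrow>\<^sub>f B \<in> \<Gamma>" if "B \<in> \<Gamma>" for A B
    using mp thms[OF SE_taut_K] that by blast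
  ultimately have "truth_set T \<Gamma>"
    using mp thms thms[OF SE_taut_bot, of F] F by unfold_locales blast+
  with F show thesis
    by (rule that[rotated -1])
qed

section \<open>Interchangeability of terms\<close>

context truth_set
begin

text \<open>Leibniz equality relative to \<open>\<Gamma>\<close>. The surrounding
  \<open>\<sigma>\<close> instantiates the other variables, which later allows variables to be
  exchanged one by one.\<close>

definition teq :: "jterm \<Rightarrow> jterm \<Rightarrow> bool" (infix "\<approx>" 50) where
  "s \<approx> t \<longleftrightarrow> (\<forall>A \<sigma> k. fsub (\<sigma>(k := s)) A \<in> \<Gamma> \<longleftrightarrow> fsub (\<sigma>(k := t)) A \<in> \<Gamma>)"

text \<open>One direction suffices, because it may be applied to negated formulas.\<close>

lemma teqI:
  assumes "\<And>A \<sigma> k. fsub (\<sigma>(k := s)) A \<in> \<Gamma> \<Longrightarrow> fsub (\<sigma>(k := t)) A \<in> \<Gamma>"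
  shows "s \<approx> t"
  unfolding teq_def
proof (intro allI iffI)
  fix A \<sigma> k
  show "fsub (\<sigma>(k := s)) A \<in> \<Gamma>" if "fsub (\<sigma>(k := t)) A \<in> \<Gamma>"
    using assms[of \<sigma> k "\<not>\<^sub>f A"] that by (auto simp: Imp_mem_iff Bot_notin)
qed (rule assms)

lemma teq_refl: "s \<approx> s" and teq_sym: "s \<approx> t \<Longrightarrow> t \<approx> s"
  and teq_trans [trans]: "r \<approx> s \<Longrightarrow> s \<approx> t \<Longrightarrow> r \<approx> t"
  by (auto simp: teq_def)

abbreviation scons3 :: "jterm \<Rightarrow> jterm \<Rightarrow> jterm \<Rightarrow> (jvar \<Rightarrow> jterm) \<Rightarrow> jvar \<Rightarrow> jterm" where
  "scons3 a b c \<sigma> n \<equiv>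
    case n of 0 \<Rightarrow> a | Suc n \<Rightarrow> (case n of 0 \<Rightarrow> b | Suc n \<Rightarrow> (case n of 0 \<Rightarrow> c | Suc n \<Rightarrow> \<sigma> n))"

text \<open>Shifting all variables of \<open>A\<close> by three makes the variables 0, 1, 2 of an axiom scheme fresh.\<close>

lemma fsub_scons3_shift:
  "fsub (scons3 a b c \<sigma>) ((fsub (\<lambda>n. Var (n + 3)) A)[k + 3/\<^sub>f l])
    = fsub (\<sigma>(k := tsub (scons3 a b c \<sigma>) l)) A"
  unfolding subst_eq_fsub fsub_fsub
  by (intro fsub_cong) (simp add: numeral_3_eq_3)

text \<open>The axioms speak of variables only; \<open>jv_fsub\<close> instantiates them at
  arbitrary terms \<open>a\<close>, \<open>b\<close>, \<open>c\<close>. The disjunction covers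
  schemes given as implications or as equivalences; \<open>teqI\<close> supplies the converse in the
  former case.\<close>

lemma axiom_teq:
  assumes "\<And>(A :: 'p formula) w. SE_axiom (A[w/\<^sub>f l] \<rightarrow>\<^sub>f A[w/\<^sub>f r]) \<or> SE_axiom (A[w/\<^sub>f l] \<leftrightarrow>\<^sub>f A[w/\<^sub>f r])"
    and "\<And>\<sigma>. tsub (scons3 a b c \<sigma>) l = s" "\<And>\<sigma>. tsub (scons3 a b c \<sigma>) r = t"
  shows "s \<approx> t"
proof (rule teqI)
  fix A :: "'p formula" and \<sigma> k
  let ?B = "fsub (\<lambda>n. Var (n + 3)) A"
  assume *: "fsub (\<sigma>(k := s)) A \<in> \<Gamma>"
  have "T \<turnstile>\<^sub>S\<^sub>E fsub (scons3 a b c \<sigma>) (?B[k + 3/\<^sub>f l] \<rightarrow>\<^sub>f ?B[k + 3/\<^sub>f r])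
      \<or> T \<turnstile>\<^sub>S\<^sub>E fsub (scons3 a b c \<sigma>) (?B[k + 3/\<^sub>f l] \<leftrightarrow>\<^sub>f ?B[k + 3/\<^sub>f r])"
    using assms(1)[of ?B "k + 3"] jv_fsub SE_derives.ax by blast
  then have "fsub (scons3 a b c \<sigma>) (?B[k + 3/\<^sub>f l] \<rightarrow>\<^sub>f ?B[k + 3/\<^sub>f r]) \<in> \<Gamma>
      \<or> fsub (scons3 a b c \<sigma>) (?B[k + 3/\<^sub>f l] \<leftrightarrow>\<^sub>f ?B[k + 3/\<^sub>f r]) \<in> \<Gamma>"
    using derivable_mem by blast
  with * show "fsub (\<sigma>(k := t)) A \<in> \<Gamma>"
    unfolding fsub_simps fsub_scons3_shift assms(2,3) Imp_mem_iff using Bot_notin by blast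
qed

section \<open>Semiring laws and congruence\<close>

lemma teq_plus_assoc: "(a +\<^sub>j b) +\<^sub>j c \<approx> a +\<^sub>j (b +\<^sub>j c)"
  by (rule axiom_teq[where a=a and b=b and c=c, OF disjI1, OF a_plus[where x=0 and y=1 and z=2]])
    (simp_all add: numeral_2_eq_2)

lemma teq_plus_commute: "a +\<^sub>j b \<approx> b +\<^sub>j a"
  by (rule axiom_teq[where a=a and b=b, OF disjI1, OF c_plus[where x=0 and y=1]]) simp_all

lemma teq_plus_zero: "a +\<^sub>j 0\<^sub>j \<approx> a"
  by (rule axiom_teq[where a=a, OF disjI2, OF zero_plus[where x=0]]) simp_all

lemma teq_times_assoc: "(a \<cdot>\<^sub>j b) \<cdot>\<^sub>j c \<approx> a \<cdot>\<^sub>j (b \<cdot>\<^sub>j c)"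
  by (rule axiom_teq[where a=a and b=b and c=c, OF disjI2, OF am[where x=0 and y=1 and z=2]])
    (simp_all add: numeral_2_eq_2)

lemma teq_times_zero: "a \<cdot>\<^sub>j 0\<^sub>j \<approx> 0\<^sub>j"
  by (rule axiom_teq[where a=a, OF disjI2, OF a0_right[where x=0]]) simp_all

lemma teq_zero_times: "0\<^sub>j \<cdot>\<^sub>j a \<approx> 0\<^sub>j"
  by (rule axiom_teq[where a=a, OF disjI2, OF a0_left[where x=0]]) simp_all

lemma teq_times_one: "a \<cdot>\<^sub>j 1\<^sub>j \<approx> a"
  by (rule axiom_teq[where a=a, OF disjI2, OF a1_right[where x=0]]) simp_all

lemma teq_one_times: "1\<^sub>j \<cdot>\<^sub>j a \<approx> a"
  by (rule axiom_teq[where a=a, OF disjI2, OF a1_left[where x=0]]) simp_all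

lemma teq_distrib_left: "a \<cdot>\<^sub>j (b +\<^sub>j c) \<approx> a \<cdot>\<^sub>j b +\<^sub>j a \<cdot>\<^sub>j c"
  by (rule axiom_teq[where a=a and b=b and c=c, OF disjI2, OF dl[where x=0 and y=1 and z=2]])
    (simp_all add: numeral_2_eq_2)

lemma teq_distrib_right: "(b +\<^sub>j c) \<cdot>\<^sub>j a \<approx> b \<cdot>\<^sub>j a +\<^sub>j c \<cdot>\<^sub>j a"
  by (rule axiom_teq[where a=a and b=b and c=c, OF disjI2, OF dr[where x=0 and y=1 and z=2]])
    (simp_all add: numeral_2_eq_2)

text \<open>Only finitely many variables occur in \<open>A\<close>. The substitutions
  \<open>\<rho> k\<close> pass from \<open>\<sigma>\<close> to \<open>\<tau>\<close> one variable at
  a time, each step being an instance of \<open>teq\<close>.\<close>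

lemma fsub_mem_cong:
  assumes "\<And>x. \<sigma> x \<approx> \<tau> x"
  shows "fsub \<sigma> A \<in> \<Gamma> \<longleftrightarrow> fsub \<tau> A \<in> \<Gamma>"
proof -
  obtain N where N: "\<And>x. x \<in> fvars A \<Longrightarrow> x < N"
    using finite_fvars[of A] by (meson finite_nat_set_iff_bounded)
  define \<rho> where "\<rho> k = (\<lambda>x. if x < k then \<tau> x else \<sigma> x)" for k :: nat
  have "fsub \<sigma> A \<in> \<Gamma> \<longleftrightarrow> fsub (\<rho> k) A \<in> \<Gamma>" for k
  proof (induction k)
    case (Suc k)
    have "(\<rho> k)(k := \<sigma> k) = \<rho> k" "(\<rho> k)(k := \<tau> k) = \<rho> (Suc k)"
      by (auto simp: \<rho>_def fun_eq_iff)
    with assms[of k] have "fsub (\<rho> k) A \<in> \<Gamma> \<longleftrightarrow> fsub (\<rho> (Suc k)) A \<in> \<Gamma>"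
      unfolding teq_def by metis
    with Suc show ?case by simp
  qed (simp add: \<rho>_def)
  moreover have "fsub (\<rho> N) A = fsub \<tau> A"
    by (intro fsub_cong) (simp add: \<rho>_def N)
  ultimately show ?thesis by metis
qed

lemma tsub_teq:
  assumes "\<And>x. \<sigma> x \<approx> \<tau> x"
  shows "tsub \<sigma> t \<approx> tsub \<tau> t"
proof (rule teqI)
  fix A :: "'p formula" and \<rho> k
  \<comment> \<open>In this formula the variables of \<open>t\<close> are even and those of \<open>A\<close> odd, so they can be
    instantiated independently.\<close>
  let ?B = "fsub (\<lambda>x. if x = k then tsub (\<lambda>y. Var (2 * y)) t else Var (2 * x + 1)) A"
  let ?mix = "\<lambda>(\<sigma> :: jvar \<Rightarrow> jterm) (n :: jvar). if even n then \<sigma> (n div 2) else \<rho> (n div 2)"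
  have mix: "fsub (?mix \<sigma>) ?B = fsub (\<rho>(k := tsub \<sigma> t)) A" for \<sigma>
    unfolding fsub_fsub by (intro fsub_cong) simp
  assume "fsub (\<rho>(k := tsub \<sigma> t)) A \<in> \<Gamma>"
  then show "fsub (\<rho>(k := tsub \<tau> t)) A \<in> \<Gamma>"
    using fsub_mem_cong[of "?mix \<sigma>" "?mix \<tau>" ?B] assms teq_refl unfolding mix by simp
qed

lemma teq_times_cong:
  assumes "a \<approx> a'" "b \<approx> b'"
  shows "a \<cdot>\<^sub>j b \<approx> a' \<cdot>\<^sub>j b'"
  using tsub_teq[of "\<lambda>n. if n = 0 then a else b" "\<lambda>n. if n = 0 then a' else b'" "Var 0 \<cdot>\<^sub>j Var 1"] assms
  by simp

lemma teq_plus_cong: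
  assumes "a \<approx> a'" "b \<approx> b'"
  shows "a +\<^sub>j b \<approx> a' +\<^sub>j b'"
  using tsub_teq[of "\<lambda>n. if n = 0 then a else b" "\<lambda>n. if n = 0 then a' else b'" "Var 0 +\<^sub>j Var 1"] assms
  by simp

text \<open>The labels of a formula are turned into variables, which reduces replacement of arbitrary
  labels to substitution.\<close>

lemma map_fml_mem_cong:
  fixes A :: "('a::countable, 'p) fml"
  assumes "\<And>x. f x \<approx> g x"
  shows "map_fml f A \<in> \<Gamma> \<longleftrightarrow> map_fml g A \<in> \<Gamma>"
proof -
  have "map_fml h A = fsub (\<lambda>n. h (from_nat n)) (map_fml (\<lambda>x. Var (to_nat x)) A)" for h
    by (simp add: fsub_def fml.map_comp comp_def)
  then show ?thesis
    using fsub_mem_cong[of "\<lambda>n. f (from_nat n)" "\<lambda>n. g (from_nat n)"] assms by metis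
qed

text \<open>Only the outer label may change, even if \<open>s\<close> also occurs in
  \<open>A\<close>: shifting \<open>A\<close> frees variable 0 to stand for that label.\<close>

lemma Just_mem_cong:
  assumes "s \<approx> t"
  shows "s \<Colon>\<^sub>f A \<in> \<Gamma> \<longleftrightarrow> t \<Colon>\<^sub>f A \<in> \<Gamma>"
proof -
  let ?\<sigma> = "\<lambda>s n. case n of 0 \<Rightarrow> s | Suc n \<Rightarrow> Var n"
  have "fsub (?\<sigma> s) (Var 0 \<Colon>\<^sub>f fsub (\<lambda>n. Var (Suc n)) A) = s \<Colon>\<^sub>f A" for s
    by simp
  then show ?thesis
    using fsub_mem_cong[of "?\<sigma> s" "?\<sigma> t"] assms teq_refl by (metis (no_types, lifting) nat.case nat.exhaust)
qed

text \<open>Axiom (j) is instantiated from variables 0 and 1 to \<open>s\<close> and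
  \<open>t\<close>; shifting \<open>A\<close> and \<open>B\<close> beforehand protects them from
  this instantiation.\<close>

lemma Just_times_mem:
  assumes "s \<Colon>\<^sub>f (A \<rightarrow>\<^sub>f B) \<in> \<Gamma>" "t \<Colon>\<^sub>f A \<in> \<Gamma>"
  shows "(s \<cdot>\<^sub>j t) \<Colon>\<^sub>f B \<in> \<Gamma>"
proof -
  let ?shift = "fsub (\<lambda>n. Var (n + 3)) :: 'p formula \<Rightarrow> 'p formula"
  have shift: "fsub (scons3 s t t Var) (?shift D) = D" for D :: "'p formula"
    by (simp add: numeral_3_eq_3)
  have "fsub (scons3 s t t Var) (Var 0 \<Colon>\<^sub>f (?shift A \<rightarrow>\<^sub>f ?shift B) \<rightarrow>\<^sub>f
      (Var 1 \<Colon>\<^sub>f ?shift A \<rightarrow>\<^sub>f (Var 0 \<cdot>\<^sub>j Var 1) \<Colon>\<^sub>f ?shift B)) \<in> \<Gamma>"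
    by (intro derivable_mem jv_fsub SE_derives.ax SE_axiom.j)
  then show ?thesis
    using assms unfolding fsub_simps shift by (simp add: Imp_mem_iff)
qed

lemma Just_plus_mem:
  assumes "s \<Colon>\<^sub>f A \<in> \<Gamma>" "t \<Colon>\<^sub>f A \<in> \<Gamma>"
  shows "(s +\<^sub>j t) \<Colon>\<^sub>f A \<in> \<Gamma>"
proof -
  let ?shift = "fsub (\<lambda>n. Var (n + 3)) :: 'p formula \<Rightarrow> 'p formula"
  have shift: "fsub (scons3 s t t Var) (?shift D) = D" for D :: "'p formula"
    by (simp add: numeral_3_eq_3)
  have "fsub (scons3 s t t Var) (Var 0 \<Colon>\<^sub>f ?shift A \<and>\<^sub>f Var 1 \<Colon>\<^sub>f ?shift A \<rightarrow>\<^sub>f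
      (Var 0 +\<^sub>j Var 1) \<Colon>\<^sub>f ?shift A) \<in> \<Gamma>"
    by (intro derivable_mem jv_fsub SE_derives.ax SE_axiom.j_plus)
  then show ?thesis
    using assms unfolding fsub_simps shift by (simp add: Imp_mem_iff Bot_notin)
qed

end

section \<open>The canonical model\<close>

instance jconst :: countable
  by countable_datatype

instance jterm :: countable
  by countable_datatype

text \<open>\<open>q\<close> realises the quotient by \<open>teq\<close> inside the type
  \<open>'s\<close>: equivalence classes become elements of \<open>range q\<close>.\<close>

locale canonical_model = truth_set T \<Gamma> for T \<Gamma> :: "'p formula set" +
  fixes q :: "jterm \<Rightarrow> 's"
  assumes q_eq_iff: "q s = q t \<longleftrightarrow> s \<approx> t"
begin

definition p :: "'s \<Rightarrow> jterm" where
  "p = inv_into UNIV q"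

definition K :: "'s ring" where
  "K = \<lparr>carrier = range q, mult = \<lambda>a b. q (p a \<cdot>\<^sub>j p b), one = q 1\<^sub>j,
        zero = q 0\<^sub>j, add = \<lambda>a b. q (p a +\<^sub>j p b)\<rparr>"

text \<open>Evidence is decoded by \<open>p\<close> into formulas over terms, whose membership in
  \<open>\<Gamma>\<close> depends on the labels only up to \<open>teq\<close>.\<close>

definition M :: "('s, 'p) model" where
  "M = \<lparr>sring = K, pval = \<lambda>P. Atom P \<in> \<Gamma>, interp = \<lambda>c. q (Const c),
        evid = {(a, A). a \<in> range q \<and> A \<in> Fml (range q) \<and> p a \<Colon>\<^sub>f map_fml p A \<in> \<Gamma>}\<rparr>"

lemma sring_M: "sring M = K"
  by (simp add: M_def)

lemma q_p: "a \<in> range q \<Longrightarrow> q (p a) = a"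
  by (simp add: p_def f_inv_into_f)

lemma p_q: "p (q s) \<approx> s"
  using q_p q_eq_iff by blast

lemma K_simps [simp]:
  "carrier K = range q" "\<one>\<^bsub>K\<^esub> = q 1\<^sub>j" "\<zero>\<^bsub>K\<^esub> = q 0\<^sub>j"
  "q s \<otimes>\<^bsub>K\<^esub> q t = q (s \<cdot>\<^sub>j t)" "q s \<oplus>\<^bsub>K\<^esub> q t = q (s +\<^sub>j t)"
  by (auto simp: K_def q_eq_iff intro: teq_times_cong teq_plus_cong p_q)

lemma K_semiring: "semiring K"
proof -
  have zero_plus: "0\<^sub>j +\<^sub>j a \<approx> a" for a
    using teq_plus_commute teq_plus_zero teq_trans by blast
  show ?thesis
    by unfold_locales
      (auto simp: q_eq_iff zero_plus intro: rangeI teq_plus_assoc teq_plus_commute teq_plus_zero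
        teq_times_assoc teq_times_one teq_one_times teq_times_zero teq_zero_times
        teq_distrib_left teq_distrib_right)
qed

lemma M_semiring_model: "semiring_model M"
proof -
  have "evidence_relation K (evid M)"
    unfolding evidence_relation_def
  proof (intro conjI allI impI)
    show "evid M \<subseteq> carrier K \<times> Fml (carrier K)"
      by (auto simp: M_def)
  next
    fix s t A B
    assume "(s, A \<rightarrow>\<^sub>f B) \<in> evid M" "(t, A) \<in> evid M"
    \<comment> \<open>The product is \<open>q (p s \<cdot>\<^sub>j p t)\<close>. Decoding it returns
      only an equivalent term, which \<open>Just_mem_cong\<close> accepts as a label.\<close>
    then show "(s \<otimes>\<^bsub>K\<^esub> t, B) \<in> evid M"
      by (auto simp: M_def K_def Fml_def Just_mem_cong[OF p_q] intro: Just_times_mem)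
  next
    fix s t A
    assume "(s, A) \<in> evid M" "(t, A) \<in> evid M"
    then show "(s \<oplus>\<^bsub>K\<^esub> t, A) \<in> evid M"
      by (auto simp: M_def K_def Fml_def Just_mem_cong[OF p_q] intro: Just_plus_mem)
  qed
  then show ?thesis
    by (simp add: semiring_model_def K_semiring interpretation_on_def M_def)
qed

lemma eval_term_eq:
  assumes "valuation_on K v"
  shows "eval_term K (interp M) v t = q (tsub (\<lambda>x. p (v x)) t)"
  using assms by (induction t) (auto simp: M_def valuation_on_def q_p)

text \<open>Truth lemma, by induction on \<open>A\<close>: the propositional cases rest on the truth
  set conditions and the choice of \<open>pval\<close>, the evidence case on the definition of
  \<open>evid\<close>.\<close>

lemma sat_iff:
  assumes "valuation_on K v"
  shows "sat M v A \<longleftrightarrow> fsub (\<lambda>x. p (v x)) A \<in> \<Gamma>"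
proof (induction A)
  case (Just t A)
  let ?\<sigma> = "\<lambda>x. p (v x)"
  have ev: "eval_term (sring M) (interp M) v = (\<lambda>t. q (tsub ?\<sigma> t))"
    using eval_term_eq[OF assms] by (simp add: M_def fun_eq_iff)
  have "sat M v (t \<Colon>\<^sub>f A) \<longleftrightarrow> map_fml (\<lambda>t. p (q (tsub ?\<sigma> t))) (t \<Colon>\<^sub>f A) \<in> \<Gamma>"
    unfolding sat.simps eval_fml_def ev
    by (auto simp: M_def Fml_def fml.set_map fml.map_comp comp_def)
  \<comment> \<open>Passing through \<open>q\<close> and back by \<open>p\<close> changes labels at
    every depth into equivalent ones, so the congruence is applied to the whole formula.\<close>
  also have "\<dots> \<longleftrightarrow> map_fml (tsub ?\<sigma>) (t \<Colon>\<^sub>f A) \<in> \<Gamma>"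
    by (rule map_fml_mem_cong) (rule p_q)
  finally show ?case
    by (simp add: fsub_def)
qed (auto simp: M_def Bot_notin Imp_mem_iff)

lemma valid_in_M: "T \<turnstile>\<^sub>S\<^sub>E A \<Longrightarrow> valid_in M A"
  using sat_iff jv_fsub[THEN derivable_mem] by (simp add: valid_in_def sring_M)

lemma valid_in_M_mem:
  assumes "valid_in M A"
  shows "A \<in> \<Gamma>"
proof -
  \<comment> \<open>Up to equivalence this valuation decodes to the identity substitution.\<close>
  have v: "valuation_on K (\<lambda>x. q (Var x))"
    by (simp add: valuation_on_def)
  then have "sat M (\<lambda>x. q (Var x)) A"
    using assms by (simp add: valid_in_def sring_M)
  then have "fsub (\<lambda>x. p (q (Var x))) A \<in> \<Gamma>"
    using sat_iff[OF v] by simp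
  then show ?thesis
    using fsub_mem_cong[of "\<lambda>x. p (q (Var x))" Var] p_q by simp
qed

end

theorem mainTheorem2:
  fixes T :: "('p::countable) formula set" and F :: "'p formula"
  assumes "infinite (UNIV :: 's set)"
    and "sem_conseq TYPE('s) T F"
  shows "T \<turnstile>\<^sub>S\<^sub>E F"
proof (rule ccontr)
  assume "\<not> T \<turnstile>\<^sub>S\<^sub>E F"
  then obtain \<Gamma> where \<Gamma>: "truth_set T \<Gamma>" and F: "F \<notin> \<Gamma>"
    by (rule truth_set_exists)
  interpret truth_set T \<Gamma> by (rule \<Gamma>)
  obtain e :: "nat \<Rightarrow> 's" where e: "inj e"
    using assms(1) infinite_countable_subset by blast
  \<comment> \<open>\<open>SOME\<close> selects one representative per class, \<open>to_nat\<close>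
    codes it as a number, and \<open>e\<close> places that number in \<open>'s\<close>.\<close>
  define q where "q t = e (to_nat (SOME s. teq t s))" for t
  have "q s = q t \<longleftrightarrow> teq s t" for s t
  proof
    have some: "teq r (SOME s. teq r s)" for r
      using teq_refl by (rule someI)
    assume "q s = q t"
    then have "(SOME r. teq s r) = (SOME r. teq t r)"
      using e by (simp add: q_def inj_eq)
    then show "teq s t"
      using some[of s] some[of t] teq_sym teq_trans by metis
  next
    assume "teq s t"
    \<comment> \<open>Equivalent terms determine the same predicate, so \<open>SOME\<close> returns
      literally the same term for both.\<close>
    then have "(\<lambda>r. teq s r) = (\<lambda>r. teq t r)"
      using teq_sym teq_trans by blast
    then show "q s = q t"
      by (simp add: q_def)
  qed
  then interpret canonical_model T \<Gamma> q
    by unfold_locales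
  have "valid_in M F"
    using assms(2) M_semiring_model valid_in_M SE_derives.hyp unfolding sem_conseq_def by blast
  then show False
    using valid_in_M_mem F by blast
qed

end
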